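(* Let $x,y,\nu$ be the parameters of the incomplete Bessel function $K_\nu(x,y)$. Define sequences $(\tilde N_n(x,y,\nu))_{n\ge -1}$ and $(D_n(x,y,\nu))_{n\ge -1}$ by the initial values $$\tilde N_{-1}(x,y,\nu)=0,\quad \tilde N_0(x,y,\nu)=0,\quad \tilde N_1(x,y,\nu)=1,$$ $$D_{-1}(x,y,\nu)=0,\quad D_0(x,y,\nu)=e^{x+y},\quad D_1(x,y,\nu)=(x+\nu+1-y)\,D_0(x,y,\nu),$$ and, for integers $n\ge 1$, by the four-term recurrence $$(n+1)\,Q_{n+1}(x,y,\nu)=(x+\nu+1+2n-y)\,Q_n(x,y,\nu)+(2y-\nu-n)\,Q_{n-1}(x,y,\nu)-y\,Q_{n-2}(x,y,\nu),$$ where $Q_n(x,y,\nu)$ stands for either $\tilde N_n(x,y,\nu)$ or $D_n(x,y,\nu)$. Let $\tilde G^{(1)}_n(x,y,\nu)$ be the $n$-th approximation to $K_\nu(x,y)$ given by the $G^{(1)}_n$ transformation, as defined in the context. Then, for all $n\ge 0$ (whenever the denominator is nonzero), $$\tilde G^{(1)}_n(x,y,\nu)=\frac{\tilde N_n(x,y,\nu)}{D_n(x,y,\nu)}.$$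
   Context: The incomplete Bessel function is $K_\nu(x,y)=\int_1^\infty \frac{e^{-xt-y/t}}{t^{\nu+1}}\,\mathrm{d}t$. For given $x,y,\nu$ set, for $t>0$, $$f(t)=\frac{e^{-xt-y/t}}{t^{\nu+1}},\qquad F(t)=\int_0^t f(s)\,\mathrm{d}s.$$ (If this integral diverges at $0$, read $F$ as any antiderivative of $f$ on $t>0$: replacing $F$ by $F+c$ with $c$ constant does not change the functions $\tilde{\mathcal N}_n$ below.) Define functions of $t>0$ recursively by $$\mathcal N_0(x,y,\nu,t)=\frac{F(t)}{f(t)},\qquad \mathcal D_0(x,y,\nu,t)=\frac{1}{f(t)},$$ and for $n\ge 1$ $$\mathcal N_n(x,y,\nu,t)=t^2\frac{\mathrm{d}}{\mathrm{d}t}\mathcal N_{n-1}(x,y,\nu,t),\qquad \mathcal D_n(x,y,\nu,t)=t^2\frac{\mathrm{d}}{\mathrm{d}t}\mathcal D_{n-1}(x,y,\nu,t).$$ Put $\tilde{\mathcal N}_n(x,y,\nu,t)=\mathcal N_n(x,y,\nu,t)-F(t)\,\mathcal D_n(x,y,\nu,t)$. For $n\ge 0$, the $n$-th approximation to $K_\nu(x,y)$ given by the $G^{(1)}_n$ transformation is $$\tilde G^{(1)}_n(x,y,\nu)=\frac{\tilde{\mathcal N}_n(x,y,\nu,1)}{\mathcal D_n(x,y,\nu,1)}.$$ *)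

theory Defs
  imports "HOL-Analysis.Analysis"
begin

text \<open>
  The parameters \<open>x\<close>, \<open>y\<close>, \<open>\<nu>\<close> are complex and \<open>t\<close> is real; only \<open>t > 0\<close> matters, where
  \<open>complex_of_real t powr (\<nu> + 1)\<close> is the usual \<open>exp ((\<nu> + 1) * ln t)\<close>. Derivatives in \<open>t\<close> are
  therefore derivatives of complex-valued functions of a real variable.
\<close>

definition bessel_f :: "complex \<Rightarrow> complex \<Rightarrow> complex \<Rightarrow> real \<Rightarrow> complex" where
  "bessel_f x y \<nu> t =
     exp (- x * complex_of_real t - y / complex_of_real t) / complex_of_real t powr (\<nu> + 1)"

text \<open>
  The function \<open>F\<close>: the integral from 0 if it converges at 0, any antiderivative on \<open>t > 0\<close>
  otherwise. By Hake's theorem, Henstock--Kurzweil integrability on \<open>{0..t}\<close> includes conditionally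
  convergent improper integrals at 0; the value of \<open>bessel_f\<close> at 0 is irrelevant.
\<close>

definition bessel_F :: "complex \<Rightarrow> complex \<Rightarrow> complex \<Rightarrow> (real \<Rightarrow> complex) \<Rightarrow> bool" where
  "bessel_F x y \<nu> F \<longleftrightarrow>
     (if \<forall>t>0. bessel_f x y \<nu> integrable_on {0..t}
      then \<forall>t>0. F t = integral {0..t} (bessel_f x y \<nu>)
      else \<forall>t>0. (F has_vector_derivative bessel_f x y \<nu> t) (at t))"

fun G_num :: "(real \<Rightarrow> complex) \<Rightarrow> nat \<Rightarrow> complex \<Rightarrow> complex \<Rightarrow> complex \<Rightarrow> real \<Rightarrow> complex" where
  "G_num F 0 x y \<nu> t = F t / bessel_f x y \<nu> t"
| "G_num F (Suc n) x y \<nu> t = complex_of_real (t\<^sup>2) * vector_derivative (G_num F n x y \<nu>) (at t)"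

fun G_den :: "nat \<Rightarrow> complex \<Rightarrow> complex \<Rightarrow> complex \<Rightarrow> real \<Rightarrow> complex" where
  "G_den 0 x y \<nu> t = 1 / bessel_f x y \<nu> t"
| "G_den (Suc n) x y \<nu> t = complex_of_real (t\<^sup>2) * vector_derivative (G_den n x y \<nu>) (at t)"

definition G_num_tilde ::
    "(real \<Rightarrow> complex) \<Rightarrow> nat \<Rightarrow> complex \<Rightarrow> complex \<Rightarrow> complex \<Rightarrow> real \<Rightarrow> complex" where
  "G_num_tilde F n x y \<nu> t = G_num F n x y \<nu> t - F t * G_den n x y \<nu> t"

text \<open>
  The approximation of \<open>\<integral>\<^sub>1\<^sup>\<infinity> bessel_f x y \<nu> t dt\<close> given by the transformation; \<open>F\<close> is
  meant to satisfy \<open>bessel_F x y \<nu> F\<close>.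
\<close>

definition G1_approx ::
    "(real \<Rightarrow> complex) \<Rightarrow> nat \<Rightarrow> complex \<Rightarrow> complex \<Rightarrow> complex \<Rightarrow> complex" where
  "G1_approx F n x y \<nu> = G_num_tilde F n x y \<nu> 1 / G_den n x y \<nu> 1"

text \<open>Sequences are indexed by \<open>int\<close> because they start at \<open>-1\<close>; smaller indices are never used.\<close>

definition four_term_rec :: "complex \<Rightarrow> complex \<Rightarrow> complex \<Rightarrow> (int \<Rightarrow> complex) \<Rightarrow> bool" where
  "four_term_rec x y \<nu> Q \<longleftrightarrow>
     (\<forall>n\<ge>1. (of_int n + 1) * Q (n + 1) =
        (x + \<nu> + 1 + 2 * of_int n - y) * Q n + (2 * y - \<nu> - of_int n) * Q (n - 1) - y * Q (n - 2))"

end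

theory Submission
  imports Defs
begin

text \<open>
  Write \<open>\<delta> = t\<^sup>2 d/dt\<close>, which is \<open>d/du\<close> in the variable \<open>u = -1/t\<close>. Logarithmic differentiation of
  \<open>1/f\<close> shows that both starting functions \<open>g = F/f\<close> and \<open>g = 1/f\<close> solve a first-order linear equation
  \<open>\<delta> g = (x t\<^sup>2 + (\<nu> + 1) t - y) g + c t\<^sup>2\<close>, with \<open>c = 1\<close> for \<open>F/f\<close> and \<open>c = 0\<close> for \<open>1/f\<close>.
  Divided by \<open>t\<^sup>2\<close>, it is \<open>u\<^sup>2 dg/du = (x - (\<nu> + 1) u - y u\<^sup>2) g + c\<close>: the coefficients are quadratic
  polynomials in \<open>u\<close> and the inhomogeneity is constant. Hence in the \<open>n\<close>-th derivative with respect to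
  \<open>u\<close> Leibniz' rule leaves only the four terms \<open>\<delta>\<^sup>n\<^sup>+\<^sup>1 g, ..., \<delta>\<^sup>n\<^sup>-\<^sup>2 g\<close>, and \<open>c\<close> disappears as soon as
  \<open>n \<ge> 1\<close> (lemma \<open>iterated_derivative_recurrence\<close>).

  At \<open>t = 1\<close>, division by \<open>n!\<close> turns this relation into the four-term recurrence (lemma
  \<open>normalized_four_term_rec\<close>). The recurrence is linear and homogeneous, so besides the numerators and
  denominators it also holds for the combination \<open>N\<^sub>n - F(1) D\<^sub>n\<close>. Comparison of the initial values then
  shows that the two given sequences are the numerators and denominators of the approximation divided
  by \<open>n!\<close>, a common factor that cancels in the quotient.
\<close>

text \<open>
  The left-hand side is \<open>t\<^sup>2\<close> times the derivative of the recurrence for the index \<open>k\<close>, where \<open>z\<close> is \<open>t\<close>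
  and \<open>a\<close>, \<open>b\<close>, \<open>h\<close> are consecutive iterated derivatives; the right-hand side is the recurrence for
  \<open>k + 1\<close>. Differentiation of the coefficients produces a term \<open>2 c z\<close> and one with the oldest derivative,
  contained in \<open>e\<close>; both are removed by the recurrence for \<open>k\<close> multiplied by \<open>2 z\<close>. The factor \<open>p\<close> is the
  truncated predecessor of \<open>k\<close>, which differs from \<open>k - 1\<close> when \<open>k = 0\<close>.
\<close>

lemma differentiated_recurrence:
  fixes a b c e h k p x y z \<nu> :: complex
  assumes "z \<noteq> 0" and p: "k * p = k * (k - 1)"
    and a: "a = (x * z ^ 2 + (\<nu> + 1 + 2 * k) * z - y) * b
      + (2 * y * z - (\<nu> + k) * z ^ 2) * (k * h) - y * z ^ 2 * e + c * z ^ 2"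
  shows "z ^ 2 * ((x * z ^ 2 + (\<nu> + 1 + 2 * k) * z - y) * (a / z ^ 2)
          + (2 * x * z + (\<nu> + 1 + 2 * k)) * b
          + ((2 * y * z - (\<nu> + k) * z ^ 2) * (k * (b / z ^ 2))
              + (2 * y - 2 * (\<nu> + k) * z) * (k * h))
          - (y * z ^ 2 * (k * p * (h / z ^ 2)) + 2 * y * z * e)
          + 2 * c * z)
    = (x * z ^ 2 + (\<nu> + 1 + 2 * (k + 1)) * z - y) * a
      + (2 * y * z - (\<nu> + (k + 1)) * z ^ 2) * ((k + 1) * b)
      - y * z ^ 2 * ((k + 1) * (k * h))"
proof -
  have cancel: "w * (A * (a / w) + P + (B * (k * (b / w)) + Q) - (y * w * (k' * (h / w)) + R) + S)
      = A * a + w * P + B * (k * b) + w * Q - w * (y * (k' * h)) - w * R + w * S"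
    if "w \<noteq> 0" for w A B P Q R S k' :: complex
    using that by (simp add: algebra_simps)
  (* in terms of the product k h, the identity is linear in a, b, d, e and c *)
  define d where "d = k * h"
  have kh: "k * (k - 1) * h = (k - 1) * d" by (simp add: d_def)
  have "z ^ 2 \<noteq> 0" using \<open>z \<noteq> 0\<close> by simp
  note cancel = cancel[OF this]
  have "2 * z * a = 2 * z * ((x * z ^ 2 + (\<nu> + 1 + 2 * k) * z - y) * b
      + (2 * y * z - (\<nu> + k) * z ^ 2) * d - y * z ^ 2 * e + c * z ^ 2)"
    unfolding a d_def ..
  then show ?thesis
    unfolding p cancel kh d_def[symmetric] by (simp add: algebra_simps power2_eq_square)
qed

text \<open>
  The equation for the derivatives of \<open>g = G 0\<close> is kept multiplied by \<open>t\<^sup>2\<close>, so that all coefficients are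
  polynomials in \<open>t\<close>. It expresses \<open>G (Suc n)\<close> by earlier functions, so differentiability passes on to \<open>G (Suc n)\<close>, and its
  derivative is the equation for \<open>Suc n\<close>. In the cases \<open>n < 2\<close> the truncated indices \<open>n - 1\<close> and
  \<open>n - 2\<close> occur with coefficient \<open>0\<close>.
\<close>

lemma iterated_derivative_recurrence:
  fixes G :: "nat \<Rightarrow> real \<Rightarrow> complex" and x y \<nu> c :: complex
  assumes step: "\<And>n t. t > 0 \<Longrightarrow>
      G (Suc n) t = complex_of_real (t\<^sup>2) * vector_derivative (G n) (at t)"
    and ode: "\<And>t. t > 0 \<Longrightarrow> (G 0 has_vector_derivative
      (x + (\<nu> + 1) / complex_of_real t - y / complex_of_real t ^ 2) * G 0 t + c) (at t)"
    and "t > 0"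
  shows "(G n has_vector_derivative G (Suc n) t / complex_of_real t ^ 2) (at t)"
    and "G (Suc n) t =
      (x * complex_of_real t ^ 2 + (\<nu> + 1 + 2 * of_nat n) * complex_of_real t - y) * G n t
      + (2 * y * complex_of_real t - (\<nu> + of_nat n) * complex_of_real t ^ 2)
          * (of_nat n * G (n - 1) t)
      - y * complex_of_real t ^ 2 * (of_nat n * of_nat (n - 1) * G (n - 2) t)
      + (if n = 0 then c else 0) * complex_of_real t ^ 2"
proof -
  let ?A = "\<lambda>n z. x * z ^ 2 + (\<nu> + 1 + 2 * of_nat n) * z - y"
  let ?B = "\<lambda>n z. 2 * y * z - (\<nu> + of_nat n) * z ^ 2"
  let ?c = "\<lambda>n::nat. if n = 0 then c else 0"
  let ?R = "\<lambda>n t. ?A n (complex_of_real t) * G n t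
      + ?B n (complex_of_real t) * (of_nat n * G (n - 1) t)
      - y * complex_of_real t ^ 2 * (of_nat n * of_nat (n - 1) * G (n - 2) t)
      + ?c n * complex_of_real t ^ 2"
  define P where "P n \<longleftrightarrow> (\<forall>t>0.
      (G n has_vector_derivative G (Suc n) t / complex_of_real t ^ 2) (at t)
      \<and> G (Suc n) t = ?R n t)" for n
  have derivI: "(G n has_vector_derivative G (Suc n) t / complex_of_real t ^ 2) (at t)"
    if "(G n has_vector_derivative d) (at t)" "t > 0" for n d t
    using that step[of t n] vector_derivative_at[OF that(1)] by simp
  have "P n"
  proof (induction n rule: less_induct)
    case (less n)
    show ?case
    proof (cases n)
      case 0
      show ?thesis
        unfolding P_def
      proof (intro allI impI conjI)
        fix t :: real assume t: "t > 0"
        show "(G n has_vector_derivative G (Suc n) t / complex_of_real t ^ 2) (at t)"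
          using derivI[OF ode] t 0 by simp
        have "G (Suc 0) t = complex_of_real t ^ 2 *
            ((x + (\<nu> + 1) / complex_of_real t - y / complex_of_real t ^ 2) * G 0 t + c)"
          using step[OF t, of 0] vector_derivative_at[OF ode[OF t]] by simp
        also have "\<dots> = ?R 0 t"
          using t by (simp add: field_simps power2_eq_square)
        finally show "G (Suc n) t = ?R n t"
          unfolding 0 .
      qed
    next
      case (Suc m)
      have eq: "G n t = ?R m t" if "t > 0" for t
      proof -
        have "P m" using less.IH Suc by simp
        then show ?thesis using that Suc unfolding P_def by blast
      qed
      have der: "(G k has_vector_derivative G (Suc k) t / complex_of_real t ^ 2) (at t)"
        if "t > 0" "k \<le> m" for k t
      proof -
        have "P k" using less.IH that Suc by simp
        then show ?thesis using that unfolding P_def by blast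
      qed
      (* the factors m and m (m - 1) make the truncated indices harmless under differentiation *)
      have der1: "((\<lambda>t. of_nat m * G (m - 1) t) has_vector_derivative
          of_nat m * (G m t / complex_of_real t ^ 2)) (at t)" if "t > 0" for t
        using has_vector_derivative_mult_right[OF der[OF that, of "m - 1"], of "of_nat m"]
        by (cases "m = 0") auto
      have der2: "((\<lambda>t. of_nat m * of_nat (m - 1) * G (m - 2) t) has_vector_derivative
          of_nat m * of_nat (m - 1) * (G (m - 1) t / complex_of_real t ^ 2)) (at t)"
        if "t > 0" for t
      proof (cases "m \<ge> 2")
        case True
        then have "Suc (m - 2) = m - 1" by simp
        then show ?thesis
          using has_vector_derivative_mult_right[OF der[OF that, of "m - 2"],
              of "of_nat m * of_nat (m - 1)"] by simp
      next
        case False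
        then have "m = 0 \<or> m = 1" by auto
        then show ?thesis by auto
      qed
      let ?R' = "\<lambda>t. (let z = complex_of_real t in
            ?A m z * (G n t / z ^ 2) + (2 * x * z + (\<nu> + 1 + 2 * of_nat m)) * G m t
          + (?B m z * (of_nat m * (G m t / z ^ 2))
              + (2 * y - 2 * (\<nu> + of_nat m) * z) * (of_nat m * G (m - 1) t))
          - (y * z ^ 2 * (of_nat m * of_nat (m - 1) * (G (m - 1) t / z ^ 2))
              + 2 * y * z * (of_nat m * of_nat (m - 1) * G (m - 2) t))
          + 2 * ?c m * z)"
      have R': "(?R m has_vector_derivative ?R' t) (at t)" if t: "t > 0" for t
        unfolding Let_def
        by (intro has_vector_derivative_add has_vector_derivative_diff
              has_vector_derivative_mult der1 der2 t
              der[OF t order_refl, folded Suc]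
              has_vector_derivative_real_field)
           (auto intro!: derivative_eq_intros)
      have Gn: "(G n has_vector_derivative ?R' t) (at t)" if t: "t > 0" for t
        by (rule has_vector_derivative_transform_within_open[OF R'[OF t], of "{0<..}"])
           (use t eq in auto)
      show ?thesis
        unfolding P_def
      proof (intro allI impI conjI)
        fix t :: real assume t: "t > 0"
        show "(G n has_vector_derivative G (Suc n) t / complex_of_real t ^ 2) (at t)"
          using derivI[OF Gn] t by simp
        define z where "z = complex_of_real t"
        have z: "z \<noteq> 0" using t by (simp add: z_def)
        have "G (Suc n) t = z ^ 2 * ?R' t"
          using step[OF t, of n] vector_derivative_at[OF Gn[OF t]] by (simp add: z_def)
        also have "\<dots> = (x * z ^ 2 + (\<nu> + 1 + 2 * (of_nat m + 1)) * z - y) * G n t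
            + (2 * y * z - (\<nu> + (of_nat m + 1)) * z ^ 2) * ((of_nat m + 1) * G m t)
            - y * z ^ 2 * ((of_nat m + 1) * (of_nat m * G (m - 1) t))"
          unfolding Let_def z_def
        proof (rule differentiated_recurrence)
          show "of_nat m * of_nat (m - 1) = (of_nat m * (of_nat m - 1) :: complex)"
            by (cases m) auto
        qed (use z eq[OF t] in \<open>simp_all add: z_def\<close>)
        also have "\<dots> = ?R n t"
          by (simp add: Suc z_def add.commute mult.assoc)
        finally show "G (Suc n) t = ?R n t" .
      qed
    qed
  qed
  then show "(G n has_vector_derivative G (Suc n) t / complex_of_real t ^ 2) (at t)"
    "G (Suc n) t = ?R n t"
    using \<open>t > 0\<close> unfolding P_def by blast+
qed

text \<open>
  If \<open>g n\<close> is an \<open>n\<close>-th derivative with respect to \<open>u = -1/t\<close>, these are the Taylor coefficients. They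
  are extended by \<open>0\<close> because the recurrence for \<open>n = 1\<close> reaches back to the index \<open>-1\<close>.
\<close>

definition taylor_seq :: "(nat \<Rightarrow> complex) \<Rightarrow> int \<Rightarrow> complex" where
  "taylor_seq g k = (if k < 0 then 0 else g (nat k) / fact (nat k))"

text \<open>
  Division by \<open>n!\<close> turns the factors \<open>n\<close> and \<open>n (n - 1)\<close> from Leibniz' rule into index shifts, because
  \<open>n g\<^sub>n\<^sub>-\<^sub>1 / n! = g\<^sub>n\<^sub>-\<^sub>1 / (n - 1)!\<close>, and leaves the factor \<open>n + 1\<close> on the left-hand side.
\<close>

lemma normalized_four_term_rec:
  fixes g :: "nat \<Rightarrow> complex"
  assumes rec: "\<And>n. n \<ge> 1 \<Longrightarrow> g (Suc n) =
      (x + \<nu> + 1 + 2 * of_nat n - y) * g n + (2 * y - \<nu> - of_nat n) * (of_nat n * g (n - 1))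
      - y * (of_nat n * of_nat (n - 1) * g (n - 2))"
  shows "four_term_rec x y \<nu> (taylor_seq g)"
  unfolding four_term_rec_def
proof (intro allI impI)
  fix k :: int assume "k \<ge> 1"
  define n where "n = nat k"
  have k: "k = int n" and n: "n \<ge> 1" using \<open>k \<ge> 1\<close> by (auto simp: n_def)
  have s1: "(of_nat n + 1) * taylor_seq g (k + 1) = g (Suc n) / fact n"
  proof -
    have "taylor_seq g (k + 1) = g (Suc n) / ((of_nat n + 1) * fact n)"
      by (simp add: taylor_seq_def k nat_add_distrib add.commute)
    moreover have "(of_nat n + 1 :: complex) \<noteq> 0"
      using of_nat_neq_0[of n, where 'a = complex] by (simp add: add.commute)
    ultimately show ?thesis by simp
  qed
  have s2: "taylor_seq g k = g n / fact n"
    by (simp add: taylor_seq_def k)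
  have s3: "taylor_seq g (k - 1) = of_nat n * g (n - 1) / fact n"
  proof -
    obtain m where m: "n = Suc m" using n by (cases n) auto
    have "(of_nat n :: complex) \<noteq> 0" using n by simp
    moreover have "fact n = (of_nat n * fact m :: complex)" by (simp add: m)
    ultimately have "of_nat n * g m / fact n = g m / fact m" by simp
    moreover have "taylor_seq g (k - 1) = g m / fact m"
      by (simp add: taylor_seq_def k m)
    moreover have "n - 1 = m" by (simp add: m)
    ultimately show ?thesis by metis
  qed
  have s4: "taylor_seq g (k - 2) = of_nat n * of_nat (n - 1) * g (n - 2) / fact n"
  proof (cases "n = 1")
    case True then show ?thesis by (simp add: taylor_seq_def k)
  next
    case False
    then obtain m where m: "n = Suc (Suc m)" using n False that[of "n - 2"] by simp
    have "fact n = (of_nat n * of_nat (n - 1) * fact m :: complex)"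
      by (simp add: m algebra_simps)
    moreover have "(of_nat n * of_nat (n - 1) :: complex) \<noteq> 0"
      by (simp add: m del: of_nat_Suc)
    ultimately have "of_nat n * of_nat (n - 1) * g m / fact n = g m / fact m"
      by simp
    moreover have "taylor_seq g (k - 2) = g m / fact m"
      by (simp add: taylor_seq_def k m)
    ultimately show ?thesis by (simp add: m)
  qed
  show "(of_int k + 1) * taylor_seq g (k + 1) =
      (x + \<nu> + 1 + 2 * of_int k - y) * taylor_seq g k
      + (2 * y - \<nu> - of_int k) * taylor_seq g (k - 1) - y * taylor_seq g (k - 2)"
    using s1 rec[OF n] unfolding s2 s3 s4
    by (simp add: k add_divide_distrib diff_divide_distrib)
qed

text \<open>The leading coefficient \<open>n + 1\<close> never vanishes, so three initial values determine a solution.\<close>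

lemma four_term_rec_unique:
  assumes "four_term_rec x y \<nu> P" "four_term_rec x y \<nu> Q"
    and "P (-1) = Q (-1)" "P 0 = Q 0" "P 1 = Q 1"
  shows "P (int n) = Q (int n)"
proof -
  have "P (int n - 1) = Q (int n - 1) \<and> P (int n) = Q (int n) \<and> P (int n + 1) = Q (int n + 1)"
  proof (induction n)
    case 0
    then show ?case using assms by simp
  next
    case (Suc n)
    let ?k = "int n + 1"
    have "(of_int ?k + 1) * P (?k + 1) = (of_int ?k + 1) * Q (?k + 1)"
      using assms(1,2)[unfolded four_term_rec_def, rule_format, of ?k] Suc by simp
    moreover have "(of_int ?k + 1 :: complex) = of_nat (Suc (Suc n))" by simp
    then have "(of_int ?k + 1 :: complex) \<noteq> 0" using of_nat_neq_0 by metis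
    ultimately have "P (?k + 1) = Q (?k + 1)" by simp
    then show ?case using Suc by (simp add: algebra_simps)
  qed
  then show ?thesis by simp
qed

lemma inverse_bessel_f:
  "1 / bessel_f x y \<nu> t =
    exp (x * complex_of_real t + y / complex_of_real t) * complex_of_real t powr (\<nu> + 1)"
  by (simp add: bessel_f_def exp_minus exp_diff exp_add field_simps)

lemma bessel_f_nonzero: "t > 0 \<Longrightarrow> bessel_f x y \<nu> t \<noteq> 0"
  by (simp add: bessel_f_def)

lemma inverse_bessel_f_has_vector_derivative:
  assumes "t > 0"
  shows "((\<lambda>t. 1 / bessel_f x y \<nu> t) has_vector_derivative
    (x + (\<nu> + 1) / complex_of_real t - y / complex_of_real t ^ 2) * (1 / bessel_f x y \<nu> t)) (at t)"
proof -
  let ?z = "complex_of_real t"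
  have z: "?z \<noteq> 0" "?z \<notin> \<real>\<^sub>\<le>\<^sub>0" using assms by auto
  have "((\<lambda>z. exp (x * z + y / z) * z powr (\<nu> + 1)) has_field_derivative
     (x + (\<nu> + 1) / ?z - y / ?z ^ 2) * (exp (x * ?z + y / ?z) * ?z powr (\<nu> + 1))) (at ?z)"
    using z by (auto intro!: derivative_eq_intros simp: powr_add powr_diff field_simps power2_eq_square)
  from has_vector_derivative_real_field[OF this] show ?thesis
    unfolding inverse_bessel_f .
qed

lemma bessel_f_isCont:
  assumes "t > 0" shows "isCont (bessel_f x y \<nu>) t"
  unfolding bessel_f_def using assms by (intro continuous_intros) auto

text \<open>
  When \<open>F\<close> is the integral from \<open>0\<close>, this is the fundamental theorem of calculus at the point \<open>t\<close>,
  where \<open>f\<close> is continuous even if it is singular at \<open>0\<close>.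
\<close>

lemma bessel_F_has_vector_derivative:
  assumes "bessel_F x y \<nu> F" "t > 0"
  shows "(F has_vector_derivative bessel_f x y \<nu> t) (at t)"
proof (cases "\<forall>t>0. bessel_f x y \<nu> integrable_on {0..t}")
  case True
  then have F: "F s = integral {0..s} (bessel_f x y \<nu>)" if "s > 0" for s
    using assms that by (simp add: bessel_F_def)
  have "((\<lambda>s. integral {0..s} (bessel_f x y \<nu>)) has_vector_derivative bessel_f x y \<nu> t)
      (at t within {0..t + 1})"
    using True assms(2) bessel_f_isCont[OF assms(2)]
    by (intro integral_has_vector_derivative_continuous_at[of _ _ _ _ "{}", simplified])
       (auto intro: continuous_at_imp_continuous_at_within)
  then have "((\<lambda>s. integral {0..s} (bessel_f x y \<nu>)) has_vector_derivative bessel_f x y \<nu> t) (at t)"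
    using at_within_interior[of t "{0..t + 1}"] assms(2) by simp
  then show ?thesis
    by (rule has_vector_derivative_transform_within_open[of _ _ _ "{0<..}"])
       (use assms(2) F in auto)
next
  case False
  then show ?thesis using assms unfolding bessel_F_def by auto
qed

theorem proposition2p2:
  fixes x y \<nu> :: complex and F :: "real \<Rightarrow> complex" and Nt D :: "int \<Rightarrow> complex"
  assumes "bessel_F x y \<nu> F"
    and "Nt (-1) = 0" and "Nt 0 = 0" and "Nt 1 = 1"
    and "D (-1) = 0" and "D 0 = exp (x + y)" and "D 1 = (x + \<nu> + 1 - y) * D 0"
    and "four_term_rec x y \<nu> Nt" and "four_term_rec x y \<nu> D"
  shows "\<forall>n::nat. D (int n) \<noteq> 0 \<longrightarrow> G1_approx F n x y \<nu> = Nt (int n) / D (int n)"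
proof -
  let ?N = "\<lambda>n. G_num F n x y \<nu>" and ?D = "\<lambda>n. G_den n x y \<nu>"
  let ?M = "\<lambda>n. G_num_tilde F n x y \<nu> 1"
  have N0: "(?N 0 has_vector_derivative
      (x + (\<nu> + 1) / complex_of_real t - y / complex_of_real t ^ 2) * ?N 0 t + 1) (at t)"
    if t: "t > 0" for t
  proof -
    have "?N 0 = (\<lambda>t. F t * (1 / bessel_f x y \<nu> t))"
      by auto
    then show ?thesis
      using has_vector_derivative_mult[OF bessel_F_has_vector_derivative[OF assms(1) t]
          inverse_bessel_f_has_vector_derivative[OF t, of x y \<nu>]] bessel_f_nonzero[OF t, of x y \<nu>]
      by (simp add: mult.commute mult.left_commute)
  qed
  have D0: "(?D 0 has_vector_derivative
      (x + (\<nu> + 1) / complex_of_real t - y / complex_of_real t ^ 2) * ?D 0 t + 0) (at t)"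
    if t: "t > 0" for t
  proof -
    have "?D 0 = (\<lambda>t. 1 / bessel_f x y \<nu> t)" by auto
    then show ?thesis
      using inverse_bessel_f_has_vector_derivative[OF t, of x y \<nu>] by simp
  qed
  have Nrec: "?N (Suc n) 1 = (x + \<nu> + 1 + 2 * of_nat n - y) * ?N n 1
      + (2 * y - \<nu> - of_nat n) * (of_nat n * ?N (n - 1) 1)
      - y * (of_nat n * of_nat (n - 1) * ?N (n - 2) 1) + (if n = 0 then 1 else 0)" for n
    using iterated_derivative_recurrence(2)[of ?N, OF G_num.simps(2) N0 zero_less_one, of n]
    by (simp add: algebra_simps)
  have Drec: "?D (Suc n) 1 = (x + \<nu> + 1 + 2 * of_nat n - y) * ?D n 1
      + (2 * y - \<nu> - of_nat n) * (of_nat n * ?D (n - 1) 1)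
      - y * (of_nat n * of_nat (n - 1) * ?D (n - 2) 1)" for n
    using iterated_derivative_recurrence(2)[of ?D, OF G_den.simps(2) D0 zero_less_one, of n]
    by (simp add: algebra_simps)
  have D_1: "?D 1 1 = (x + \<nu> + 1 - y) * ?D 0 1"
    using Drec[of 0] by (simp add: algebra_simps)
  have M_1: "?M 1 = 1"
    using Nrec[of 0] Drec[of 0] by (simp add: G_num_tilde_def algebra_simps)
  have "four_term_rec x y \<nu> (taylor_seq (\<lambda>n. ?D n 1))"
  proof (rule normalized_four_term_rec)
    show "?D (Suc n) 1 = (x + \<nu> + 1 + 2 * of_nat n - y) * ?D n 1
        + (2 * y - \<nu> - of_nat n) * (of_nat n * ?D (n - 1) 1)
        - y * (of_nat n * of_nat (n - 1) * ?D (n - 2) 1)" if "n \<ge> 1" for n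
      by (rule Drec)
  qed
  then have D_eq: "D (int n) = ?D n 1 / fact n" for n
    using four_term_rec_unique[OF assms(9), of "taylor_seq (\<lambda>n. ?D n 1)" n] assms(5,6,7) D_1
    by (simp add: taylor_seq_def inverse_bessel_f)
  have "four_term_rec x y \<nu> (taylor_seq ?M)"
  proof (rule normalized_four_term_rec)
    show "?M (Suc n) = (x + \<nu> + 1 + 2 * of_nat n - y) * ?M n
        + (2 * y - \<nu> - of_nat n) * (of_nat n * ?M (n - 1))
        - y * (of_nat n * of_nat (n - 1) * ?M (n - 2))" if "n \<ge> 1" for n
      unfolding G_num_tilde_def Nrec Drec using that by (simp add: algebra_simps)
  qed
  then have N_eq: "Nt (int n) = ?M n / fact n" for n
    using four_term_rec_unique[OF assms(8), of "taylor_seq ?M" n] assms(2,3,4) M_1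
    by (simp add: taylor_seq_def G_num_tilde_def)
  show ?thesis
    by (simp add: D_eq N_eq G1_approx_def)
qed

end
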